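(* Let $x$ be such that $0<p_1(x)\le\alpha\le0.1$. Then $C_x(z)$ has a unique zero $\lambda=\lambda(x)$, of order of multiplicity $1$, inside an interval of the form $(1,1+lp_1)$, such that $$\left|\lambda-(1+p_1-p_2+p_3-p_4+2p_1^2+3p_2^2-5p_1p_2)\right|\le K(\alpha)\,p_1^3,$$ where $l=l(\alpha)>t_2^3(\alpha)$, $t_2(\alpha)$ is the second root (in increasing order) of the equation $\alpha t^3-t+1=0$, and $K(\alpha)$ is given by $$K(\alpha)=\frac{\dfrac{11-3\alpha}{(1-\alpha)^2}+2l(1+3\alpha)\dfrac{2+3l\alpha-\alpha(2-l\alpha)(1+l\alpha)^2}{\left[1-\alpha(1+l\alpha)^2\right]^3}}{1-\dfrac{2\alpha(1+l\alpha)}{\left[1-\alpha(1+l\alpha)^2\right]^2}} .$$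
   Context: $(X_n)_{n\ge1}$ is a strictly stationary sequence of random variables that is 1-dependent, i.e. for every $t\ge1$ the $\sigma$-fields $\sigma(X_1,\dots,X_t)$ and $\sigma(X_{t+2},X_{t+3},\dots)$ are independent. Let $F(u)=\mathbb{P}(X_1\le u)$, and let the real number $x$ satisfy $\inf\{u: F(u)>0\}<x<\sup\{u: F(u)<1\}$. Put $p_0=1$ and $p_n=p_n(x)=\mathbb{P}(\min\{X_1,\dots,X_n\}>x)$ for $n\ge1$, and let $C(z)=C_x(z)=1+\sum_{k=1}^{\infty}(-1)^kp_{k-1}z^k$. *)

theory Defs
  imports "HOL-Probability.Probability" "HOL-Complex_Analysis.Complex_Analysis"
begin

text \<open>
  Sequences \<open>(X\<^sub>n)\<close> with \<open>n \<ge> 1\<close> are functions \<open>X :: nat \<Rightarrow> 'a \<Rightarrow> real\<close> whose value at index \<open>0\<close>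
  is never used.
\<close>

definition gen_sigma :: "'a measure \<Rightarrow> (nat \<Rightarrow> 'a \<Rightarrow> real) \<Rightarrow> nat set \<Rightarrow> 'a set set" where
  "gen_sigma M X I = sigma_sets (space M) {X i -` A \<inter> space M | i A. i \<in> I \<and> A \<in> sets borel}"

definition strictly_stationary :: "'a measure \<Rightarrow> (nat \<Rightarrow> 'a \<Rightarrow> real) \<Rightarrow> bool" where
  "strictly_stationary M X \<longleftrightarrow>
     (\<forall>J h. finite J \<longrightarrow> J \<subseteq> {1..} \<longrightarrow>
        distr M (Pi\<^sub>M J (\<lambda>_. borel)) (\<lambda>\<omega>. \<lambda>j\<in>J. X (j + h) \<omega>) =
        distr M (Pi\<^sub>M J (\<lambda>_. borel)) (\<lambda>\<omega>. \<lambda>j\<in>J. X j \<omega>))"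

definition one_dependent :: "'a measure \<Rightarrow> (nat \<Rightarrow> 'a \<Rightarrow> real) \<Rightarrow> bool" where
  "one_dependent M X \<longleftrightarrow>
     (\<forall>t\<ge>1. prob_space.indep_set M (gen_sigma M X {1..t}) (gen_sigma M X {t + 2..}))"

definition p :: "'a measure \<Rightarrow> (nat \<Rightarrow> 'a \<Rightarrow> real) \<Rightarrow> real \<Rightarrow> nat \<Rightarrow> real" where
  "p M X x n =
     (if n = 0 then 1 else measure M {\<omega> \<in> space M. Min ((\<lambda>i. X i \<omega>) ` {1..n}) > x})"

text \<open>The summation index is shifted by one: the term with index \<open>k\<close> is the one of degree \<open>k + 1\<close>.\<close>

definition C :: "'a measure \<Rightarrow> (nat \<Rightarrow> 'a \<Rightarrow> real) \<Rightarrow> real \<Rightarrow> complex \<Rightarrow> complex" where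
  "C M X x z = 1 + (\<Sum>k. (- 1) ^ Suc k * of_real (p M X x k) * z ^ Suc k)"

text \<open>
  The second real root, in increasing order, of \<open>\<alpha> t\<^sup>3 - t + 1 = 0\<close>. For \<open>0 < \<alpha> < 4/27\<close> there
  are three real roots, the first of which is negative, and the list index is legitimate.
\<close>

definition t2 :: "real \<Rightarrow> real" where
  "t2 \<alpha> = sorted_list_of_set {t :: real. \<alpha> * t ^ 3 - t + 1 = 0} ! 1"

definition K :: "real \<Rightarrow> real \<Rightarrow> real" where
  "K \<alpha> l =
     ((11 - 3 * \<alpha>) / (1 - \<alpha>)\<^sup>2 +
      2 * l * (1 + 3 * \<alpha>) *
        ((2 + 3 * l * \<alpha> - \<alpha> * (2 - l * \<alpha>) * (1 + l * \<alpha>)\<^sup>2) / (1 - \<alpha> * (1 + l * \<alpha>)\<^sup>2) ^ 3)) /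
     (1 - 2 * \<alpha> * (1 + l * \<alpha>) / (1 - \<alpha> * (1 + l * \<alpha>)\<^sup>2)\<^sup>2)"

text \<open>
  The values \<open>l > t\<^sub>2\<^sup>3\<close> for which the denominators in \<open>K\<close> are positive. These two conditions
  cannot be dropped from a statement about every such \<open>l\<close>: when the second denominator is negative
  and the first positive, \<open>K\<close> itself is negative, and for large \<open>l\<close> the interval
  \<open>(1, 1 + l p\<^sub>1)\<close> can contain a second zero of \<open>C\<close> or leave its disc of convergence. The first
  condition guarantees that the interval lies inside the disc of convergence of \<open>C\<close>, since
  stationarity and 1-dependence give \<open>p\<^sub>n \<le> p\<^sub>1 ^ \<lceil>n / 2\<rceil>\<close>.
\<close>

definition admissible :: "real \<Rightarrow> real \<Rightarrow> bool" where
  "admissible \<alpha> l \<longleftrightarrow>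
     t2 \<alpha> ^ 3 < l \<and>
     0 < 1 - \<alpha> * (1 + l * \<alpha>)\<^sup>2 \<and>
     0 < 1 - 2 * \<alpha> * (1 + l * \<alpha>) / (1 - \<alpha> * (1 + l * \<alpha>)\<^sup>2)\<^sup>2"

end

theory Submission
  imports Defs
begin

text \<open>
  Let \<open>e = p\<^sub>1\<close>. Three facts about the probabilities \<open>p\<^sub>n\<close> suffice: they decrease; they satisfy
  \<open>p\<^sub>n\<^sub>+\<^sub>2 \<le> e p\<^sub>n\<close>, since leaving one index out makes the two sides independent
  (\<open>min_gt_prob_gap\<close>); and \<open>p\<^sub>2 < e\<close> (\<open>min_gt_prob_2_less_1\<close>). The rest is about an alternating power
  series with such coefficients.

  The coefficients \<open>p\<^sub>2\<^sub>j\<^sub>+\<^sub>1\<close> and \<open>p\<^sub>2\<^sub>j\<^sub>+\<^sub>2\<close> are at most \<open>e\<^sup>j\<^sup>+\<^sup>1\<close>. So \<open>C\<close> is analytic where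
  \<open>e |z|\<^sup>2 < 1\<close>, and summing the positive terms of the derivative at a real \<open>r \<ge> 0\<close> gives
    \<open>C' r \<le> -1 + 2 e r / (1 - e r\<^sup>2)\<^sup>2\<close>.
  The inequalities in \<open>admissible\<close> besides \<open>l > t\<^sub>2\<^sup>3\<close> say that the bound is finite and negative for
  \<open>r = 1 + l \<alpha>\<close> and \<open>e = \<alpha>\<close>, hence for every \<open>r\<close> in \<open>[1, 1 + l e]\<close>. On that interval \<open>C\<close> is therefore
  strictly decreasing, which gives uniqueness and simplicity of the zero. Existence follows from two
  signs. First, \<open>C 1 = (p\<^sub>1 - p\<^sub>2) + (p\<^sub>3 - p\<^sub>4) + \<dots> > 0\<close>. Second, \<open>C (1 + e + 3 e\<^sup>2) \<le> 0\<close>, and this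
  point lies inside the interval because \<open>t\<^sub>2 = 1 + \<alpha> t\<^sub>2\<^sup>3 \<ge> 1 + \<alpha>\<close> gives \<open>l > t\<^sub>2\<^sup>3 > 1 + 3 \<alpha>\<close>.

  The zero \<open>\<zeta> = 1 + d\<close> thus satisfies \<open>0 < d \<le> e + 3 e\<^sup>2\<close>, whatever \<open>l\<close> is. The approximation to \<open>d\<close>
  is \<open>(p\<^sub>1 - p\<^sub>2) + (p\<^sub>3 - p\<^sub>4) + (p\<^sub>1 - p\<^sub>2) (2 p\<^sub>1 - 3 p\<^sub>2)\<close>, which up to third order is the Newton step
  \<open>- C 1 / C' 1\<close>. Substituting \<open>1 + d\<close> into \<open>C = 0\<close> and comparing shows that the error is at most
  \<open>(15 + 75 e) e\<^sup>3\<close> (\<open>newton_remainder\<close>, \<open>alt_gf_zero_expansion\<close>). On the other side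
  \<open>K \<alpha> l \<ge> 15 + 75 \<alpha>\<close> for all admissible \<open>l\<close> (\<open>K_lower_bound\<close>), and \<open>e \<le> \<alpha>\<close>.
\<close>

section \<open>Exceedance probabilities of a 1-dependent stationary sequence\<close>

lemma min_gt_eq:
  assumes "1 \<le> n"
  shows "p M X x n = measure M {\<omega> \<in> space M. \<forall>i\<in>{1..n}. x < X i \<omega>}"
  using assms by (simp add: p_def)

text \<open>
  Stationarity enters only through probabilities that all of finitely many \<open>X\<^sub>j\<close> exceed \<open>x\<close>: such
  an event is the preimage of a box under the finite-dimensional vector, whose law is
  shift-invariant.\<close>

lemma stationary_exceedance:
  assumes meas: "\<And>n. 1 \<le> n \<Longrightarrow> X n \<in> borel_measurable M"
    and stat: "strictly_stationary M X"
    and J: "finite J" "J \<subseteq> {1..}"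
  shows "measure M {\<omega> \<in> space M. \<forall>j\<in>J. x < X (j + h) \<omega>}
       = measure M {\<omega> \<in> space M. \<forall>j\<in>J. x < X j \<omega>}"
proof -
  define B :: "(nat \<Rightarrow> real) set" where "B = (\<Pi>\<^sub>E j\<in>J. {x<..})"
  have B: "B \<in> sets (Pi\<^sub>M J (\<lambda>_. borel))"
    unfolding B_def by (rule sets_PiM_I_finite) (use J in auto)
  have shift: "measure (distr M (Pi\<^sub>M J (\<lambda>_. borel)) (\<lambda>\<omega>. \<lambda>j\<in>J. X (j + k) \<omega>)) B
      = measure M {\<omega> \<in> space M. \<forall>j\<in>J. x < X (j + k) \<omega>}" for k
  proof -
    have "(\<lambda>\<omega>. \<lambda>j\<in>J. X (j + k) \<omega>) \<in> measurable M (Pi\<^sub>M J (\<lambda>_. borel))"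
      by (rule measurable_restrict) (use J meas in force)
    moreover have "(\<lambda>\<omega>. \<lambda>j\<in>J. X (j + k) \<omega>) -` B \<inter> space M
        = {\<omega> \<in> space M. \<forall>j\<in>J. x < X (j + k) \<omega>}"
      by (auto simp: B_def PiE_iff)
    ultimately show ?thesis
      using B by (simp add: measure_distr)
  qed
  show ?thesis
    using shift[of h] shift[of 0] stat J unfolding strictly_stationary_def by simp
qed

lemma min_gt_prob_nonneg: "0 \<le> p M X x n"
  by (simp add: p_def)

context prob_space
begin

lemma exceedance_event:
  assumes meas: "\<And>n. 1 \<le> n \<Longrightarrow> X n \<in> borel_measurable M"
    and J: "finite J" "J \<subseteq> {1..}"
  shows "{\<omega> \<in> space M. \<forall>j\<in>J. (x :: real) < X j \<omega>} \<in> events"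
proof -
  have "{\<omega> \<in> space M. x < X j \<omega>} \<in> events" if "j \<in> J" for j
  proof -
    have [measurable]: "X j \<in> borel_measurable M" using that J meas by auto
    show ?thesis by measurable
  qed
  then show ?thesis
    using J by (intro sets.sets_Collect_finite_All) auto
qed

lemma min_gt_prob_Suc_le:
  assumes meas: "\<And>n. 1 \<le> n \<Longrightarrow> X n \<in> borel_measurable M"
  shows "p M X x (Suc n) \<le> p M X x n"
proof (cases "n = 0")
  case True
  then show ?thesis by (simp add: p_def)
next
  case False
  have "{\<omega> \<in> space M. \<forall>i\<in>{1..n}. x < X i \<omega>} \<in> events"
    by (rule exceedance_event) (use meas in auto)
  then show ?thesis
    using False by (simp add: min_gt_eq del: atLeastAtMost_iff) (intro finite_measure_mono, auto)
qed

lemma exceedance_in_gen_sigma: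
  assumes J: "finite J" "J \<subseteq> I" "J \<noteq> {}"
  shows "{\<omega> \<in> space M. \<forall>j\<in>J. x < X j \<omega>} \<in> gen_sigma M X I"
proof -
  let ?G = "{X i -` A \<inter> space M | i A. i \<in> I \<and> A \<in> sets borel}"
  interpret S: sigma_algebra "space M" "sigma_sets (space M) ?G"
    by (rule sigma_algebra_sigma_sets) auto
  have gen: "X j -` {x<..} \<inter> space M \<in> sigma_sets (space M) ?G" if "j \<in> J" for j
  proof -
    have "j \<in> I" "{x<..} \<in> sets borel" using that J by auto
    then have "X j -` {x<..} \<inter> space M \<in> ?G" by blast
    then show ?thesis by (rule sigma_sets.Basic)
  qed
  have "{\<omega> \<in> space M. \<forall>j\<in>J. x < X j \<omega>} = (\<Inter>j\<in>J. X j -` {x<..} \<inter> space M)"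
    unfolding vimage_def greaterThan_def using J(3) by blast
  also have "\<dots> \<in> sigma_sets (space M) ?G"
    by (rule S.finite_INT[OF J(1,3)]) (rule gen)
  finally show ?thesis unfolding gen_sigma_def .
qed

text \<open>
  Dropping the constraint at time \<open>n + 1\<close> enlarges the event and leaves a gap of one index between
  \<open>X\<^sub>1, \<dots>, X\<^sub>n\<close> and \<open>X\<^sub>n\<^sub>+\<^sub>2\<close>, across which 1-dependence makes the two parts independent. This is
  the source of all geometric decay of the sequence \<open>p\<close>.\<close>

lemma min_gt_prob_gap:
  assumes meas: "\<And>n. 1 \<le> n \<Longrightarrow> X n \<in> borel_measurable M"
    and stat: "strictly_stationary M X" and dep: "one_dependent M X"
  shows "p M X x (n + 2) \<le> p M X x 1 * p M X x n"
proof (cases "n = 0")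
  case True
  have "p M X x 2 \<le> p M X x 1"
    using min_gt_prob_Suc_le[of X x 1] meas unfolding Suc_1 by blast
  moreover have "p M X x 0 = 1"
    by (simp add: p_def)
  ultimately show ?thesis using True by (simp add: numeral_2_eq_2)
next
  case False
  let ?A = "{\<omega> \<in> space M. \<forall>j\<in>{1..n}. x < X j \<omega>}"
  let ?B = "{\<omega> \<in> space M. \<forall>j\<in>{n+2}. x < X j \<omega>}"
  have "?A \<in> gen_sigma M X {1..n}" "?B \<in> gen_sigma M X {n+2..}"
    using False by (intro exceedance_in_gen_sigma; force)+
  then have "prob (?A \<inter> ?B) = prob ?A * prob ?B"
    using dep False unfolding one_dependent_def by (intro indep_setD) auto
  moreover have "prob ?B = p M X x 1"
    using stationary_exceedance[OF meas stat, of "{1}" x "n + 1"]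
    by (simp add: min_gt_eq add.commute)
  moreover have "prob ?A = p M X x n"
    using False by (simp add: min_gt_eq)
  moreover have "p M X x (n + 2) \<le> prob (?A \<inter> ?B)"
  proof -
    have "?A \<in> events" "?B \<in> events"
      by (intro exceedance_event; use meas in force)+
    then show ?thesis
      by (subst min_gt_eq) (auto intro!: finite_measure_mono sets.Int)
  qed
  ultimately show ?thesis by (simp add: mult.commute)
qed

text \<open>
  The event that \<open>X\<^sub>1, X\<^sub>2\<close> exceed \<open>x\<close> and \<open>X\<^sub>3\<close> does not is contained in the event that \<open>X\<^sub>2\<close> exceeds
  \<open>x\<close> and \<open>X\<^sub>3\<close> does not, so by stationarity \<open>p\<^sub>2 - p\<^sub>3 \<le> p\<^sub>1 - p\<^sub>2\<close>. If \<open>p\<^sub>2\<close> were equal to \<open>p\<^sub>1\<close>, this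
  would force \<open>p\<^sub>3 = p\<^sub>1\<close>, against \<open>p\<^sub>3 \<le> p\<^sub>1\<^sup>2 < p\<^sub>1\<close>. The strictness is what keeps the zero of \<open>C\<close>
  away from the left end point \<open>1\<close> of the interval.\<close>

lemma min_gt_prob_2_less_1:
  assumes meas: "\<And>n. 1 \<le> n \<Longrightarrow> X n \<in> borel_measurable M"
    and stat: "strictly_stationary M X" and dep: "one_dependent M X"
    and p1: "0 < p M X x 1" "p M X x 1 < 1"
  shows "p M X x 2 < p M X x 1"
proof -
  let ?E = "\<lambda>J. {\<omega> \<in> space M. \<forall>j\<in>J. x < X j \<omega>}"
  have ev: "?E J \<in> events" if "J \<subseteq> {1..3}" for J
    using that meas by (intro exceedance_event) (auto intro: finite_subset)
  have p_eq: "p M X x 1 = prob (?E {2})" "p M X x 2 = prob (?E {1,2})"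
      "p M X x 2 = prob (?E {2,3})" "p M X x 3 = prob (?E {1,2,3})"
  proof -
    have iv: "{1..2} = {1,2::nat}" "{1..3} = {1,2,3::nat}" by auto
    show "p M X x 1 = prob (?E {2})"
      using stationary_exceedance[OF meas stat, of "{1}" x 1]
      by (simp add: min_gt_eq numeral_2_eq_2)
    show "p M X x 2 = prob (?E {1,2})" "p M X x 3 = prob (?E {1,2,3})"
      by (simp_all add: min_gt_eq iv del: One_nat_def)
    then show "p M X x 2 = prob (?E {2,3})"
      using stationary_exceedance[OF meas stat, of "{1,2}" x 1] by (simp add: eval_nat_numeral)
  qed
  have "prob (?E {1,2}) - prob (?E {1,2,3}) = prob (?E {1,2} - ?E {1,2,3})"
    by (rule finite_measure_Diff[symmetric]) (use ev[of "{1,2}"] ev[of "{1,2,3}"] in auto)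
  also have "\<dots> \<le> prob (?E {2} - ?E {2,3})"
    by (rule finite_measure_mono) (use ev[of "{2}"] ev[of "{2,3}"] in auto)
  also have "\<dots> = prob (?E {2}) - prob (?E {2,3})"
    by (rule finite_measure_Diff) (use ev[of "{2}"] ev[of "{2,3}"] in auto)
  finally have "p M X x 2 - p M X x 3 \<le> p M X x 1 - p M X x 2"
    using p_eq by linarith
  moreover have "p M X x 3 \<le> p M X x 1 * p M X x 1"
    using min_gt_prob_gap[OF meas stat dep, of x 1] by (simp add: numeral_3_eq_3)
  moreover have "p M X x 1 * p M X x 1 < p M X x 1"
    using p1 by simp
  ultimately show ?thesis by linarith
qed

end

section \<open>Alternating series with submultiplicative coefficients\<close>

text \<open>
  This is \<open>C\<close> for an arbitrary coefficient sequence, over the reals as well as over the complex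
  numbers: signs and monotonicity are studied on the real line, the order of the zero in the
  complex plane.\<close>

definition alt_gf :: "(nat \<Rightarrow> real) \<Rightarrow> 'a::{real_normed_field,banach} \<Rightarrow> 'a" where
  "alt_gf q z = 1 + (\<Sum>k. (- 1) ^ Suc k * of_real (q k) * z ^ Suc k)"

definition alt_gf' :: "(nat \<Rightarrow> real) \<Rightarrow> 'a::{real_normed_field,banach} \<Rightarrow> 'a" where
  "alt_gf' q z = (\<Sum>k. of_nat (Suc k) * (- 1) ^ Suc k * of_real (q k) * z ^ k)"

lemma neg_one_power_double [simp]: "(- 1 :: 'a::ring_1) ^ (j + j) = 1"
  by (simp flip: mult_2)

text \<open>
  All estimates of the alternating series are made on sums of two consecutive terms, whose
  signs can be controlled.\<close>

lemma sums_pairs: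
  fixes f :: "nat \<Rightarrow> 'a::real_normed_vector"
  assumes "f sums s"
  shows "(\<lambda>j. f (2 * j) + f (2 * j + 1)) sums s"
proof -
  have "sum f {j * 2..<j * 2 + 2} = f (2 * j) + f (2 * j + 1)" for j
    by (simp add: numeral_2_eq_2 mult.commute)
  then show ?thesis
    using sums_group[OF assms, of 2] by simp
qed

text \<open>
  The properties of the probabilities \<open>p\<^sub>n\<close> on which the analysis of \<open>C\<close> rests.\<close>

locale gap_submultiplicative =
  fixes q :: "nat \<Rightarrow> real"
  assumes q_0: "q 0 = 1"
    and q_1_pos: "0 < q 1"
    and q_nonneg: "0 \<le> q n"
    and q_Suc_le: "q (Suc n) \<le> q n"
    and q_gap: "q (n + 2) \<le> q 1 * q n"
begin

lemma q_1_le_1: "q 1 \<le> 1"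
  using q_Suc_le[of 0] q_0 by simp

text \<open>
  The crude form of the decay, uniform in the parity of the index; it gives convergence of the
  series for \<open>q\<^sub>1 |z|\<^sup>2 < 1\<close>.\<close>

lemma q_le_sqrt_power: "q n \<le> sqrt (q 1) ^ n"
proof (induction n rule: induct_nat_012)
  case 0
  show ?case by (simp add: q_0)
next
  case 1
  have "q 1 * q 1 \<le> 1 * q 1"
    using q_1_le_1 q_1_pos by (intro mult_right_mono) auto
  then show ?case
    using q_1_pos by (auto intro!: real_le_rsqrt simp: power2_eq_square)
next
  case (ge2 n)
  have "q (n + 2) \<le> q 1 * sqrt (q 1) ^ n"
    using q_gap[of n] mult_left_mono[OF ge2(1), of "q 1"] q_1_pos by linarith
  also have "\<dots> = sqrt (q 1) ^ (n + 2)"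
    using q_1_pos by (simp add: power_add)
  finally show ?case by simp
qed

text \<open>
  The sharp form of the decay. Together with \<open>q_Suc_le\<close> it bounds the terms of index \<open>2j + 1\<close> and
  \<open>2j + 2\<close> by the same power \<open>q\<^sub>1\<^sup>j\<^sup>+\<^sup>1\<close>.\<close>

lemma q_odd_le: "q (2 * j + 1) \<le> q 1 ^ Suc j"
proof (induction j)
  case (Suc j)
  have "q (2 * Suc j + 1) \<le> q 1 * q (2 * j + 1)"
    using q_gap[of "2 * j + 1"] by simp
  also have "\<dots> \<le> q 1 * q 1 ^ Suc j"
    using Suc q_1_pos by (intro mult_left_mono) auto
  finally show ?case by simp
qed simp

lemma summable_terms:
  fixes z :: "'a::{real_normed_field,banach}"
  assumes "sqrt (q 1) * norm z < 1"
  shows "summable (\<lambda>k. (- 1) ^ Suc k * of_real (q k) * z ^ Suc k)"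
proof (rule summable_comparison_test')
  show "summable (\<lambda>k. norm z * (sqrt (q 1) * norm z) ^ k)"
    using assms q_1_pos by (intro summable_mult summable_geometric) auto
  show "norm ((- 1) ^ Suc k * of_real (q k) * z ^ Suc k) \<le> norm z * (sqrt (q 1) * norm z) ^ k" for k
  proof -
    have "norm ((- 1) ^ Suc k * of_real (q k) * z ^ Suc k) = q k * (norm z * norm z ^ k)"
      using q_nonneg[of k] by (simp add: norm_mult norm_power)
    also have "\<dots> \<le> sqrt (q 1) ^ k * (norm z * norm z ^ k)"
      using q_le_sqrt_power by (intro mult_right_mono) auto
    finally show ?thesis by (simp add: power_mult_distrib mult_ac)
  qed
qed

lemma disc_iff: "0 \<le> r \<Longrightarrow> sqrt (q 1) * r < 1 \<longleftrightarrow> q 1 * r\<^sup>2 < 1"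
  using abs_square_less_1[of "sqrt (q 1) * r"] q_1_pos by (simp add: power_mult_distrib)

text \<open>
  The shifted index of the sum is absorbed into the coefficients \<open>c\<close> of an ordinary power series,
  so that termwise differentiation applies.\<close>

lemma alt_gf_deriv_sums:
  fixes z :: "'a::{real_normed_field,banach}"
  assumes z: "q 1 * (norm z)\<^sup>2 < 1"
  shows "(alt_gf q has_field_derivative alt_gf' q z) (at z)"
    and "(\<lambda>k. of_nat (Suc k) * (- 1) ^ Suc k * of_real (q k) * z ^ k) sums alt_gf' q z"
proof -
  define c :: "nat \<Rightarrow> 'a" where
    "c n = (case n of 0 \<Rightarrow> 1 | Suc k \<Rightarrow> (- 1) ^ Suc k * of_real (q k))" for n
  define \<rho> where "\<rho> = 1 / sqrt (q 1)"
  have \<rho>: "norm w < \<rho> \<longleftrightarrow> sqrt (q 1) * norm w < 1" for w :: 'a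
    using q_1_pos by (simp add: \<rho>_def field_simps)
  have c_sums: "(\<lambda>n. c n * w ^ n) sums alt_gf q w" if w: "norm w < \<rho>" for w
  proof -
    have "(\<lambda>k. c (Suc k) * w ^ Suc k) sums (alt_gf q w - 1)"
      using summable_sums[OF summable_terms, of w] w[unfolded \<rho>]
      by (simp add: c_def alt_gf_def)
    then show ?thesis
      using sums_Suc_iff[of "\<lambda>n. c n * w ^ n" "alt_gf q w - 1"] by (simp add: c_def)
  qed
  have z': "norm z < \<rho>" using z unfolding \<rho> by (subst disc_iff) auto
  have diffs_c: "diffs c k * z ^ k = of_nat (Suc k) * (- 1) ^ Suc k * of_real (q k) * z ^ k" for k
    by (simp add: diffs_def c_def)
  have "((\<lambda>w. \<Sum>n. c n * w ^ n) has_field_derivative (\<Sum>n. diffs c n * z ^ n)) (at z)"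
    by (rule termdiffs_strong'[OF sums_summable[OF c_sums] z'])
  then show D: "(alt_gf q has_field_derivative alt_gf' q z) (at z)"
    unfolding alt_gf'_def diffs_c
  proof (rule has_field_derivative_transform_within_open)
    show "open (ball (0::'a) \<rho>)" "z \<in> ball 0 \<rho>" using z' by auto
  qed (use c_sums in \<open>auto simp: sums_iff\<close>)
  show "(\<lambda>k. of_nat (Suc k) * (- 1) ^ Suc k * of_real (q k) * z ^ k) sums alt_gf' q z"
    using termdiffs_sums_strong[OF c_sums D z'] unfolding diffs_c .
qed

lemma alt_gf_of_real:
  assumes "q 1 * r\<^sup>2 < 1"
  shows "alt_gf q (complex_of_real r) = of_real (alt_gf q r)"
proof -
  have "sqrt (q 1) * norm r < 1" using assms by (subst disc_iff) auto
  then show ?thesis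
    using suminf_of_real[OF summable_terms[of r], where 'a = complex] by (simp add: alt_gf_def)
qed

lemma alt_gf'_of_real:
  assumes "q 1 * r\<^sup>2 < 1"
  shows "alt_gf' q (complex_of_real r) = of_real (alt_gf' q r)"
proof -
  have "q 1 * (norm r)\<^sup>2 < 1" using assms by simp
  from sums_of_real[OF alt_gf_deriv_sums(2)[OF this], where 'a = complex]
  show ?thesis by (simp add: alt_gf'_def sums_iff)
qed

lemma alt_gf_pair_sums:
  fixes r :: real
  assumes "q 1 * r\<^sup>2 < 1"
  shows "(\<lambda>j. q (2 * j + 1) * r ^ (2 * j + 2) - q (2 * j + 2) * r ^ (2 * j + 3)) sums (alt_gf q r - (1 - r))"
proof -
  let ?f = "\<lambda>k. (- 1) ^ Suc k * q k * r ^ Suc k"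
  have "sqrt (q 1) * norm r < 1" using assms by (subst disc_iff) auto
  then have "?f sums (alt_gf q r - 1)"
    using summable_sums[OF summable_terms[of r]] by (simp add: alt_gf_def)
  then have "(\<lambda>k. ?f (Suc k)) sums (alt_gf q r - (1 - r))"
    using sums_Suc_iff[of ?f] by (simp add: q_0)
  from sums_pairs[OF this] show ?thesis
    by (simp add: eval_nat_numeral mult_ac)
qed

text \<open>
  With \<open>0 \<le> q\<^sub>2\<^sub>j\<^sub>+\<^sub>2 \<le> q\<^sub>2\<^sub>j\<^sub>+\<^sub>1\<close>, a pair is largest when its second coefficient vanishes, and
  smallest when both coincide; in the latter case it is \<open>(1 - r)\<close> times its first term.\<close>

lemma pair_bounds:
  fixes r :: real
  assumes r: "1 \<le> r"
  shows "q (2 * j + 1) * r ^ (2 * j + 2) - q (2 * j + 2) * r ^ (2 * j + 3) \<le> q 1 ^ Suc j * r ^ (2 * j + 2)"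
    and "r \<le> 2 \<Longrightarrow> - (q 1 ^ Suc j * r ^ (2 * j + 2)) \<le> q (2 * j + 1) * r ^ (2 * j + 2) - q (2 * j + 2) * r ^ (2 * j + 3)"
proof -
  let ?a = "q (2 * j + 1)" and ?b = "q (2 * j + 2)" and ?s = "r ^ (2 * j + 2)"
  have s: "0 \<le> ?s" using r by simp
  have b: "0 \<le> ?b" "?b \<le> ?a" using q_nonneg q_Suc_le[of "2*j+1"] by auto
  have a: "?a * ?s \<le> q 1 ^ Suc j * ?s" using q_odd_le s by (rule mult_right_mono)
  have e: "r ^ (2 * j + 3) = r * ?s" by (simp add: eval_nat_numeral)
  show "?a * ?s - ?b * r ^ (2 * j + 3) \<le> q 1 ^ Suc j * ?s"
    using a b r by (smt (verit) mult_nonneg_nonneg zero_le_power)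
  assume r2: "r \<le> 2"
  have "?b * (r * ?s) \<le> ?a * (2 * ?s)"
    using b r r2 s by (intro mult_mono mult_right_mono mult_nonneg_nonneg) auto
  then show "- (q 1 ^ Suc j * ?s) \<le> ?a * ?s - ?b * r ^ (2 * j + 3)"
    unfolding e using a by linarith
qed

lemma alt_gf_at_1_pos:
  assumes "q 1 < 1" "q 2 < q 1"
  shows "0 < alt_gf q (1 :: real)"
proof -
  let ?g = "\<lambda>j. q (2 * j + 1) - q (2 * j + 2)"
  have g: "?g sums alt_gf q (1 :: real)"
    using alt_gf_pair_sums[of 1] assms by simp
  have "0 \<le> ?g j" for j
    using q_Suc_le[of "2 * j + 1"] by simp
  then have "sum ?g {..<1} \<le> suminf ?g"
    using g by (intro sum_le_suminf) (auto simp: sums_iff)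
  then show ?thesis using g assms(2) by (simp add: sums_iff numeral_2_eq_2)
qed

text \<open>
  Here the pairs start with a negative term, so that the bound beyond \<open>1 - r + q\<^sub>1 r\<^sup>2\<close> acquires the
  small factor \<open>r - 1\<close>: by \<open>q\<^sub>2\<^sub>j\<^sub>+\<^sub>3 \<le> q\<^sub>2\<^sub>j\<^sub>+\<^sub>2\<close> each pair is at most
  \<open>q\<^sub>2\<^sub>j\<^sub>+\<^sub>3 r\<^sup>2\<^sup>j\<^sup>+\<^sup>3 (r - 1)\<close>, and the sum over \<open>j\<close> is dominated by a geometric series.\<close>

lemma alt_gf_le:
  fixes r :: real
  assumes r: "1 \<le> r" "q 1 * r\<^sup>2 < 1"
  shows "alt_gf q r \<le> 1 - r + q 1 * r\<^sup>2 + (r - 1) * (q 1)\<^sup>2 * r ^ 3 / (1 - q 1 * r\<^sup>2)"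
proof -
  let ?f = "\<lambda>k. (- 1) ^ Suc k * q k * r ^ Suc k"
  let ?s = "q 1 * r\<^sup>2"
  let ?g = "\<lambda>j. q (2 * j + 3) * r ^ (2 * j + 4) - q (2 * j + 2) * r ^ (2 * j + 3)"
  have "sqrt (q 1) * norm r < 1" using r by (subst disc_iff) auto
  then have "?f sums (alt_gf q r - 1)"
    using summable_sums[OF summable_terms[of r]] by (simp add: alt_gf_def)
  then have "(\<lambda>k. ?f (k + 2)) sums (alt_gf q r - 1 - (\<Sum>k<2. ?f k))"
    by (subst sums_iff_shift) simp
  then have "(\<lambda>k. ?f (k + 2)) sums (alt_gf q r - (1 - r + ?s))"
    by (simp add: eval_nat_numeral q_0 algebra_simps)
  from sums_pairs[OF this] have g: "?g sums (alt_gf q r - (1 - r + ?s))"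
    by (simp add: eval_nat_numeral mult_ac)
  have h: "(\<lambda>j. (r - 1) * (q 1)\<^sup>2 * r ^ 3 * ?s ^ j) sums ((r - 1) * (q 1)\<^sup>2 * r ^ 3 * (1 / (1 - ?s)))"
    using r q_1_pos by (intro sums_mult geometric_sums) auto
  have "?g j \<le> (r - 1) * (q 1)\<^sup>2 * r ^ 3 * ?s ^ j" for j
  proof -
    have "q (2 * j + 3) \<le> q (2 * j + 2)" using q_Suc_le[of "2 * j + 2"] by (simp add: eval_nat_numeral)
    then have "?g j \<le> q (2 * j + 3) * r ^ (2 * j + 4) - q (2 * j + 3) * r ^ (2 * j + 3)"
      using r by (intro diff_left_mono mult_right_mono) auto
    also have "\<dots> = q (2 * j + 3) * (r ^ (2 * j + 3) * (r - 1))"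
      by (simp add: eval_nat_numeral algebra_simps)
    also have "\<dots> \<le> q 1 ^ (j + 2) * (r ^ (2 * j + 3) * (r - 1))"
      using q_odd_le[of "Suc j"] r by (intro mult_right_mono) (auto simp: eval_nat_numeral)
    also have "\<dots> = (r - 1) * (q 1)\<^sup>2 * r ^ 3 * ?s ^ j"
      by (simp add: power_add power_mult power_mult_distrib power2_eq_square mult_ac)
    finally show ?thesis .
  qed
  from sums_le[OF this g h] show ?thesis by simp
qed

text \<open>
  Only the positive terms, those of odd coefficient index, are kept. With \<open>q_odd_le\<close> they form the
  differentiated geometric series of \<open>q\<^sub>1 r\<^sup>2\<close>. At the right end point of the interval of the theorem
  with \<open>q\<^sub>1 = \<alpha>\<close>, minus this bound is the denominator of \<open>K\<close>.\<close>

lemma alt_gf'_le: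
  fixes r :: real
  assumes r: "0 \<le> r" "q 1 * r\<^sup>2 < 1"
  shows "alt_gf' q r \<le> - 1 + 2 * q 1 * r / (1 - q 1 * r\<^sup>2)\<^sup>2"
proof -
  let ?f = "\<lambda>k. real (Suc k) * (- 1) ^ Suc k * q k * r ^ k"
  let ?s = "q 1 * r\<^sup>2"
  let ?g = "\<lambda>j. real (2 * j + 2) * q (2 * j + 1) * r ^ (2 * j + 1) - real (2 * j + 3) * q (2 * j + 2) * r ^ (2 * j + 2)"
  have "?f sums alt_gf' q r"
    using alt_gf_deriv_sums(2)[of r] r by simp
  then have "(\<lambda>k. ?f (Suc k)) sums (alt_gf' q r + 1)"
    using sums_Suc_iff[of ?f] by (simp add: q_0)
  from sums_pairs[OF this] have g: "?g sums (alt_gf' q r + 1)"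
    by (simp add: algebra_simps)
  have h: "(\<lambda>j. 2 * q 1 * r * (real (Suc j) * ?s ^ j)) sums (2 * q 1 * r * (1 / (1 - ?s)\<^sup>2))"
    using r q_1_pos by (intro sums_mult geometric_deriv_sums) auto
  have "?g j \<le> 2 * q 1 * r * (real (Suc j) * ?s ^ j)" for j
  proof -
    have "?g j \<le> real (2 * j + 2) * q (2 * j + 1) * r ^ (2 * j + 1)"
      using r q_nonneg[of "2 * j + 2"] by simp
    also have "\<dots> \<le> real (2 * j + 2) * q 1 ^ Suc j * r ^ (2 * j + 1)"
      using r q_odd_le[of j] by (intro mult_right_mono mult_left_mono) auto
    also have "\<dots> = 2 * q 1 * r * (real (Suc j) * ?s ^ j)"
      by (simp add: power_add power_mult_distrib algebra_simps flip: power_mult)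
    finally show ?thesis .
  qed
  from sums_le[OF this g h] show ?thesis by simp
qed

text \<open>
  The terms from degree 6 on contribute only to third order in \<open>q\<^sub>1\<close>.\<close>

lemma alt_gf_tail:
  fixes r :: real
  assumes r: "1 \<le> r" "r \<le> 2" "q 1 * r\<^sup>2 < 1"
  shows "\<bar>alt_gf q r - (1 - r + q 1 * r\<^sup>2 - q 2 * r ^ 3 + q 3 * r ^ 4 - q 4 * r ^ 5)\<bar>
    \<le> q 1 ^ 3 * r ^ 6 / (1 - q 1 * r\<^sup>2)"
proof -
  let ?s = "q 1 * r\<^sup>2"
  let ?g = "\<lambda>j. q (2 * j + 1) * r ^ (2 * j + 2) - q (2 * j + 2) * r ^ (2 * j + 3)"
  let ?R = "alt_gf q r - (1 - r + q 1 * r\<^sup>2 - q 2 * r ^ 3 + q 3 * r ^ 4 - q 4 * r ^ 5)"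
  have "(\<lambda>j. ?g (j + 2)) sums (alt_gf q r - (1 - r) - (\<Sum>j<2. ?g j))"
    by (subst sums_iff_shift) (simp only: diff_add_cancel alt_gf_pair_sums[OF r(3)])
  then have g: "(\<lambda>j. ?g (j + 2)) sums ?R"
    by (simp add: eval_nat_numeral algebra_simps)
  have h: "(\<lambda>j. q 1 ^ 3 * r ^ 6 * ?s ^ j) sums (q 1 ^ 3 * r ^ 6 * (1 / (1 - ?s)))"
    using r q_1_pos by (intro sums_mult geometric_sums) auto
  have eq: "q 1 ^ Suc (j + 2) * r ^ (2 * (j + 2) + 2) = q 1 ^ 3 * r ^ 6 * ?s ^ j" for j
    by (simp add: eval_nat_numeral power_add power_mult power_mult_distrib mult_ac)
  have "?R \<le> q 1 ^ 3 * r ^ 6 * (1 / (1 - ?s))"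
    by (rule sums_le[OF _ g h]) (use pair_bounds(1)[OF r(1)] eq in metis)
  moreover have "- (q 1 ^ 3 * r ^ 6 * (1 / (1 - ?s))) \<le> ?R"
    by (rule sums_le[OF _ sums_minus[OF h] g]) (use pair_bounds(2)[OF r(1,2)] eq in metis)
  ultimately show ?thesis by simp
qed

end

section \<open>The error of the third-order approximation\<close>

text \<open>
  Here \<open>e\<close>, \<open>a\<close>, \<open>b\<close>, \<open>c\<close> stand for \<open>p\<^sub>1\<close>, \<open>p\<^sub>2\<close>, \<open>p\<^sub>3\<close>, \<open>p\<^sub>4\<close>, the zero is \<open>1 + d\<close>, \<open>R\<close> collects the terms
  of the series from degree 6 on, and the last hypothesis says that the series vanishes at
  \<open>1 + d\<close>. The second-order part of the approximation is
  \<open>2 e\<^sup>2 + 3 a\<^sup>2 - 5 e a = (2 e - 3 a) (e - a)\<close>, and \<open>d\<close> is \<open>e - a\<close> up to second order, so the error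
  is
    \<open>(2 e - 3 a) (d - (e - a)) + ((e - 3 a) d\<^sup>2 - a d\<^sup>3) + (b ((1 + d)\<^sup>4 - 1) - c ((1 + d)\<^sup>5 - 1)) + R\<close>,
  in which every summand has third order. As \<open>e\<close> tends to \<open>0\<close>, the lower bound that is available
  for \<open>K\<close> tends to \<open>15\<close>, and adding the worst cases over \<open>a\<close> of the summands, with the constants
  used below, would exceed that.
  The first two summands are therefore bounded jointly: the gain from \<open>|2 e - 3 a| \<le> 2 e - a\<close>
  pays for the growth of the second summand with \<open>a\<close>.\<close>

lemma newton_remainder:
  fixes e a b c d R :: real
  assumes e: "0 < e" "e \<le> 1/10" and a: "0 \<le> a" "a \<le> e"
    and bc: "0 \<le> c" "c \<le> b" "b \<le> e\<^sup>2" and d: "0 \<le> d" "d \<le> e + 3 * e\<^sup>2"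
    and R: "\<bar>R\<bar> \<le> 12/5 * e ^ 3"
    and eq: "d = e * (1 + d)\<^sup>2 - a * (1 + d) ^ 3 + b * (1 + d) ^ 4 - c * (1 + d) ^ 5 + R"
  shows "\<bar>d - (e - a + b - c + 2 * e\<^sup>2 + 3 * a\<^sup>2 - 5 * e * a)\<bar> \<le> (15 + 75 * e) * e ^ 3"
proof -
  define L4 where "L4 = (1 + d) ^ 4"
  have L5: "(1 + d) ^ 5 = L4 * (1 + d)" by (simp add: L4_def eval_nat_numeral)
  \<comment> \<open>The numerical constants below are bounds that hold up to the extreme case e = 1/10, d = 13/100.\<close>
  have "e\<^sup>2 \<le> e * (1/10)" using e by (simp add: power2_eq_square)
  then have d1: "d \<le> 13/10 * e" using d by linarith
  then have d2: "d \<le> 13/100" using e by linarith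
  have dd: "d * d \<le> 13/100 * d" using d d2 by (intro mult_right_mono) auto
  have L4: "1 \<le> L4" "L4 \<le> 1 + 97/20 * d" "L4 \<le> 33/20"
  proof -
    have "L4 = 1 + 4 * d + 6 * (d * d) + 4 * (d * (d * d)) + d * d * (d * d)"
      by (simp add: L4_def eval_nat_numeral algebra_simps)
    moreover have "d * (d * d) \<le> d * (13/100 * d)"
      by (rule mult_left_mono[OF dd d(1)])
    moreover have "d * d * (d * d) \<le> (13/100 * d) * (13/100 * d)"
      by (rule mult_mono[OF dd dd]) (use d in auto)
    ultimately have up: "L4 \<le> 1 + 97/20 * d" using dd d d2 by simp
    show "1 \<le> L4" unfolding L4_def by (rule one_le_power) (use d in simp)
    show "L4 \<le> 1 + 97/20 * d" by (rule up)
    then show "L4 \<le> 33/20" using d2 by linarith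
  qed
  define D1 where "D1 = d - (e - a)"
  define T1 where "T1 = (2 * e - 3 * a) * d + (e - 3 * a) * d\<^sup>2 - a * d ^ 3"
  define T2 where "T2 = b * L4 - c * (1 + d) ^ 5"
  define S1 where "S1 = (e - 3 * a) * d\<^sup>2 - a * d ^ 3"
  define S2 where "S2 = b * (L4 - 1) - c * ((1 + d) ^ 5 - 1)"
  have D1: "D1 = T1 + T2 + R"
    unfolding D1_def T1_def T2_def L4_def using eq by (simp add: eval_nat_numeral algebra_simps)
  have total: "d - (e - a + b - c + 2 * e\<^sup>2 + 3 * a\<^sup>2 - 5 * e * a) = (2 * e - 3 * a) * D1 + S1 + S2 + R"
    unfolding D1_def S1_def S2_def L4_def using eq by (simp add: eval_nat_numeral algebra_simps)
  \<comment> \<open>B bounds |D1|, that is, the second-order error of the approximation e - a to d.\<close>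
  define B where "B = 2 * e * d + e * d\<^sup>2 + e\<^sup>2 * (1 + 97/20 * d) + 12/5 * e ^ 3"
  have pos: "0 \<le> a * d" "0 \<le> a * d\<^sup>2" "0 \<le> a * d ^ 3" "0 \<le> e * d\<^sup>2" "0 \<le> e * d"
    using a d e by auto
  have le: "a * d \<le> e * d" "a * d\<^sup>2 \<le> e * d\<^sup>2" "a * d ^ 3 \<le> e * d ^ 3"
    using a d by (auto intro: mult_right_mono)
  have dpow: "e * d\<^sup>2 \<le> 13/100 * (e * d)" "e * d ^ 3 \<le> 13/100 * (e * d\<^sup>2)"
    using mult_left_mono[OF dd, of e] mult_left_mono[OF dd, of "e * d"] e d
    by (simp_all add: power2_eq_square power3_eq_cube mult_ac)
  have "\<bar>T1\<bar> \<le> 2 * e * d + e * d\<^sup>2"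
  proof -
    have "T1 = 2 * (e * d) - 3 * (a * d) + e * d\<^sup>2 - 3 * (a * d\<^sup>2) - a * d ^ 3"
      by (simp add: T1_def algebra_simps)
    then show ?thesis using pos le dpow by simp
  qed
  moreover have "\<bar>T2\<bar> \<le> e\<^sup>2 * L4"
  proof -
    have "c * (L4 * (1 + d)) \<le> b * (L4 * (1 + d))" "0 \<le> c * (L4 * (1 + d))" "b * L4 \<le> e\<^sup>2 * L4"
      using bc L4 d by (auto intro!: mult_right_mono)
    moreover have bL: "0 \<le> b * L4" using bc L4 by simp
    moreover have "b * L4 * d \<le> b * L4 * 1" by (rule mult_left_mono[OF _ bL]) (use d2 in simp)
    ultimately show ?thesis unfolding T2_def L5 by (simp add: algebra_simps)
  qed
  moreover have "e\<^sup>2 * L4 \<le> e\<^sup>2 * (1 + 97/20 * d)"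
    using L4 by (intro mult_left_mono) auto
  ultimately have "\<bar>D1\<bar> \<le> B"
    unfolding D1 B_def using R by linarith
  moreover have "\<bar>2 * e - 3 * a\<bar> \<le> 2 * e - a" using a by linarith
  ultimately have "\<bar>(2 * e - 3 * a) * D1\<bar> \<le> (2 * e - a) * B"
    unfolding abs_mult by (intro mult_mono) auto
  moreover have "\<bar>S1\<bar> \<le> e * d\<^sup>2 + a * ((1 + d) * d\<^sup>2)"
  proof -
    have "S1 = e * d\<^sup>2 - 3 * (a * d\<^sup>2) - a * d ^ 3" "a * ((1 + d) * d\<^sup>2) = a * d\<^sup>2 + a * d ^ 3"
      by (simp_all add: S1_def eval_nat_numeral algebra_simps)
    then show ?thesis using pos le by simp
  qed
  \<comment> \<open>The part of the bound on S1 that grows with a is absorbed by the term - a * B.\<close>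
  moreover have "a * ((1 + d) * d\<^sup>2) \<le> a * B"
  proof (rule mult_left_mono)
    have "(1 + d) * d\<^sup>2 \<le> 113/100 * (13/10 * e * d)"
      unfolding power2_eq_square using d d1 d2 by (intro mult_mono mult_right_mono) auto
    also have "\<dots> \<le> 2 * e * d" using pos by (simp add: mult.commute)
    also have "\<dots> \<le> B" unfolding B_def using e d by simp
    finally show "(1 + d) * d\<^sup>2 \<le> B" .
  qed (use a in simp)
  moreover have "\<bar>S2\<bar> \<le> 97/20 * (e\<^sup>2 * d)"
  proof -
    have L51: "0 \<le> L4 * (1 + d) - 1" using L4(1) d mult_mono[of 1 L4 1 "1 + d"] by simp
    have "S2 \<le> b * (L4 - 1)" unfolding S2_def L5 using L51 bc by simp
    also have "\<dots> \<le> e\<^sup>2 * (97/20 * d)" using L4 bc d by (intro mult_mono) auto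
    finally have 1: "S2 \<le> 97/20 * (e\<^sup>2 * d)" by simp
    have "c * (L4 * (1 + d) - 1) \<le> b * (L4 * (1 + d) - 1)"
      using L51 bc by (intro mult_right_mono) auto
    then have "- S2 \<le> b * (L4 * d)" unfolding S2_def L5 by (simp add: algebra_simps)
    also have "\<dots> \<le> e\<^sup>2 * (97/20 * d)" using L4 bc d by (intro mult_mono mult_right_mono) auto
    finally show ?thesis using 1 by simp
  qed
  ultimately have "\<bar>(2 * e - 3 * a) * D1 + S1 + S2 + R\<bar>
      \<le> 2 * e * B + e * d\<^sup>2 + 97/20 * (e\<^sup>2 * d) + 12/5 * e ^ 3"
    using R by (simp add: algebra_simps)
  also have "\<dots> \<le> (15 + 75 * e) * e ^ 3"
  proof -
    \<comment> \<open>Every factor d is at most e * v, so what remains is a polynomial in e.\<close>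
    define v where "v = 1 + 3 * e"
    have dv: "d \<le> e * v" using d by (simp add: v_def algebra_simps power2_eq_square)
    have v: "1 \<le> v" "v \<le> 13/10" using e by (auto simp: v_def)
    have vv: "v * v \<le> 13/10 * v" using v by (intro mult_right_mono) auto
    have d2v: "d\<^sup>2 \<le> e\<^sup>2 * (13/10 * v)"
    proof -
      have "d\<^sup>2 \<le> (e * v) * (e * v)" unfolding power2_eq_square using dv d by (intro mult_mono) auto
      also have "\<dots> = e\<^sup>2 * (v * v)" by (simp add: power2_eq_square)
      also have "\<dots> \<le> e\<^sup>2 * (13/10 * v)" using vv by (intro mult_left_mono) auto
      finally show ?thesis .
    qed
    have t: "4 * (e\<^sup>2 * d) \<le> 4 * (e\<^sup>2 * (e * v))" "2 * (e\<^sup>2 * d\<^sup>2) \<le> 2 * (e\<^sup>2 * (e\<^sup>2 * (13/10 * v)))"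
       "97/10 * (e ^ 3 * d) \<le> 97/10 * (e ^ 3 * (e * v))" "e * d\<^sup>2 \<le> e * (e\<^sup>2 * (13/10 * v))"
       "97/20 * (e\<^sup>2 * d) \<le> 97/20 * (e\<^sup>2 * (e * v))"
      using mult_left_mono[OF dv, of "e\<^sup>2"] mult_left_mono[OF dv, of "e ^ 3"]
        mult_left_mono[OF d2v, of "e\<^sup>2"] mult_left_mono[OF d2v, of e] e
      by (simp_all add: mult_ac)
    have "2 * e * B + e * d\<^sup>2 + 97/20 * (e\<^sup>2 * d) + 12/5 * e ^ 3
       = 4 * (e\<^sup>2 * d) + 2 * (e\<^sup>2 * d\<^sup>2) + 97/10 * (e ^ 3 * d) + e * d\<^sup>2 + 97/20 * (e\<^sup>2 * d)
         + 2 * e ^ 3 + 24/5 * (e * e ^ 3) + 12/5 * e ^ 3"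
      by (simp add: B_def power2_eq_square power3_eq_cube algebra_simps)
    also have "\<dots> \<le> e ^ 3 * (4 * v + 13/5 * (e * v) + 97/10 * (e * v) + 13/10 * v + 97/20 * v
         + 2 + 24/5 * e + 12/5)"
      using t by (simp add: power2_eq_square power3_eq_cube algebra_simps)
    also have "\<dots> \<le> e ^ 3 * (15 + 75 * e)"
    proof (intro mult_left_mono)
      have "e * v \<le> e * (13/10)" using v e by (intro mult_left_mono) auto
      then show "4 * v + 13/5 * (e * v) + 97/10 * (e * v) + 13/10 * v + 97/20 * v
         + 2 + 24/5 * e + 12/5 \<le> 15 + 75 * e"
        using e v_def by linarith
    qed (use e in simp)
    finally show ?thesis by (simp add: mult.commute)
  qed
  finally show ?thesis unfolding total .
qed

text \<open>
  A bound without \<open>l\<close> that grows with \<open>\<alpha>\<close> allows \<open>\<alpha>\<close> to be replaced by the smaller \<open>p\<^sub>1\<close>. With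
  \<open>s = \<alpha> (1 + l \<alpha>)\<^sup>2 < 1\<close>, the numerator of the inner fraction is
  \<open>2 (1 - s) + l \<alpha> (3 + s)\<close>, and \<open>s \<ge> \<alpha>\<close>. The fractions in \<open>K\<close> are estimated separately by linear
  functions that agree with their limits at \<open>\<alpha> = 0\<close>, \<open>l = 1\<close>.\<close>

lemma K_lower_bound:
  assumes \<alpha>: "0 < \<alpha>" "\<alpha> \<le> 1/10" and l: "1 \<le> l" and adm: "admissible \<alpha> l"
  shows "15 + 75 * \<alpha> \<le> K \<alpha> l"
proof -
  define s where "s = \<alpha> * (1 + l * \<alpha>)\<^sup>2"
  define V where "V = 1 - 2 * \<alpha> * (1 + l * \<alpha>) / (1 - s)\<^sup>2"
  define N where "N = 2 + 3 * l * \<alpha> - \<alpha> * (2 - l * \<alpha>) * (1 + l * \<alpha>)\<^sup>2"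
  have s1: "s < 1" and V0: "0 < V"
    using adm by (auto simp: admissible_def s_def V_def)
  have la: "\<alpha> \<le> l * \<alpha>" using l \<alpha> by simp
  have s0: "\<alpha> \<le> s"
    using \<alpha> la unfolding s_def by (simp add: one_le_power)
  have u: "0 < (1 - s) ^ 3" "(1 - s) ^ 3 \<le> 1" "0 < (1 - s)\<^sup>2" "(1 - s)\<^sup>2 \<le> 1"
    using s0 s1 \<alpha> by (auto intro!: power_le_one)
  have first: "11 + 19 * \<alpha> \<le> (11 - 3 * \<alpha>) / (1 - \<alpha>)\<^sup>2"
  proof -
    have "\<alpha> * \<alpha> * \<alpha> \<le> \<alpha> * \<alpha> * 1" using \<alpha> by (intro mult_left_mono) auto
    moreover have "0 \<le> \<alpha> * \<alpha>" by simp
    moreover have "(11 + 19 * \<alpha>) * (1 - \<alpha>)\<^sup>2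
        = 11 - 3 * \<alpha> - 27 * (\<alpha> * \<alpha>) + 19 * (\<alpha> * \<alpha> * \<alpha>)"
      by (simp add: power2_eq_square algebra_simps)
    ultimately have "(11 + 19 * \<alpha>) * (1 - \<alpha>)\<^sup>2 \<le> 11 - 3 * \<alpha>" by linarith
    then show ?thesis using \<alpha> by (subst pos_le_divide_eq) auto
  qed
  have second: "2 + 7 * \<alpha> \<le> N / (1 - s) ^ 3"
  proof -
    have "(1 - s)\<^sup>2 \<le> (1 - \<alpha>)\<^sup>2" using s0 s1 by (intro power_mono) auto
    then have "(1 + 2 * \<alpha>) * (1 - s)\<^sup>2 \<le> (1 + 2 * \<alpha>) * (1 - \<alpha>)\<^sup>2"
      using \<alpha> by (intro mult_left_mono) auto
    also have "\<dots> \<le> 1"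
    proof -
      have "\<alpha> * \<alpha> * \<alpha> \<le> \<alpha> * \<alpha> * 1" using \<alpha> by (intro mult_left_mono) auto
      moreover have "0 \<le> \<alpha> * \<alpha>" by simp
      moreover have "(1 + 2 * \<alpha>) * (1 - \<alpha>)\<^sup>2 = 1 - 3 * (\<alpha> * \<alpha>) + 2 * (\<alpha> * \<alpha> * \<alpha>)"
        by (simp add: power2_eq_square algebra_simps)
      ultimately show ?thesis by linarith
    qed
    finally have "(1 - s) * ((1 + 2 * \<alpha>) * (1 - s)\<^sup>2) \<le> (1 - s) * 1"
      using s1 by (intro mult_left_mono) auto
    moreover have "\<alpha> * (1 - s) ^ 3 \<le> \<alpha> * 1" using u \<alpha> by (intro mult_left_mono) auto
    moreover have "0 \<le> l * \<alpha> * s" using l \<alpha> s0 by simp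
    ultimately have "(2 + 7 * \<alpha>) * (1 - s) ^ 3 \<le> 2 * (1 - s) + l * \<alpha> * (3 + s)"
      using la by (simp add: power3_eq_cube power2_eq_square algebra_simps)
    also have "\<dots> = N" by (simp add: N_def s_def algebra_simps)
    finally show ?thesis using u by (subst pos_le_divide_eq) auto
  qed
  have "4 + 26 * \<alpha> \<le> 1 * (2 * (1 + 3 * \<alpha>)) * (2 + 7 * \<alpha>)"
    using \<alpha> by (simp add: algebra_simps)
  also have "\<dots> \<le> l * (2 * (1 + 3 * \<alpha>)) * (N / (1 - s) ^ 3)"
    using second l \<alpha> by (intro mult_mono mult_right_mono) auto
  finally have num: "15 + 45 * \<alpha> \<le> (11 - 3 * \<alpha>) / (1 - \<alpha>)\<^sup>2 + 2 * l * (1 + 3 * \<alpha>) * (N / (1 - s) ^ 3)"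
    using first by (simp add: algebra_simps)
  have V1: "V \<le> 1 - 2 * \<alpha>"
  proof -
    have "2 * \<alpha> * (1 - s)\<^sup>2 \<le> 2 * \<alpha> * 1" using u \<alpha> by (intro mult_left_mono) auto
    also have "\<dots> \<le> 2 * \<alpha> * (1 + l * \<alpha>)" using la \<alpha> by simp
    finally have "2 * \<alpha> \<le> 2 * \<alpha> * (1 + l * \<alpha>) / (1 - s)\<^sup>2"
      using u by (subst pos_le_divide_eq) auto
    then show ?thesis by (simp add: V_def)
  qed
  have "(15 + 75 * \<alpha>) * V \<le> (15 + 75 * \<alpha>) * (1 - 2 * \<alpha>)"
    using V1 \<alpha> by (intro mult_left_mono) auto
  also have "\<dots> \<le> 15 + 45 * \<alpha>"
    by (simp add: algebra_simps)
  finally have "15 + 75 * \<alpha> \<le> ((11 - 3 * \<alpha>) / (1 - \<alpha>)\<^sup>2 + 2 * l * (1 + 3 * \<alpha>) * (N / (1 - s) ^ 3)) / V"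
    using num V0 by (subst pos_le_divide_eq) auto
  then show ?thesis by (simp add: K_def N_def V_def s_def)
qed

text \<open>
  The cubic \<open>f t = \<alpha> t\<^sup>3 - t + 1\<close> changes sign below \<open>-3\<close> and between \<open>1\<close> and \<open>29/25\<close>. Since it has
  no quadratic term, its three roots add up to \<open>0\<close>, so the third one exceeds \<open>3 - 29/25\<close> and
  the root in between is the second.\<close>

lemma t2_root:
  assumes \<alpha>: "0 < \<alpha>" "\<alpha> \<le> 1/10"
  shows "\<alpha> * t2 \<alpha> ^ 3 - t2 \<alpha> + 1 = 0" "1 < t2 \<alpha>" "t2 \<alpha> < 29/25"
proof -
  define f where "f t = \<alpha> * t ^ 3 - t + 1" for t :: real
  have cont: "continuous_on A f" for A unfolding f_def by (intro continuous_intros)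
  define y where "y = 1 / \<alpha>"
  have y: "10 \<le> y" "\<alpha> * y = 1" using \<alpha> by (auto simp: y_def field_simps)
  have "f (- y) < 0"
  proof -
    have "f (- y) = y + 1 - \<alpha> * y * (y * y)"
      by (simp add: f_def power3_eq_cube)
    moreover have "10 * y \<le> y * y" using y by (intro mult_right_mono) auto
    moreover have "\<alpha> * y * (y * y) = y * y" using y by simp
    ultimately show ?thesis using y(1) by linarith
  qed
  moreover have "0 < f (- 3)" using \<alpha> by (simp add: f_def)
  ultimately obtain r0 where r0: "f r0 = 0" "r0 \<le> - 3" "r0 \<noteq> - 3"
    using IVT'[of f "- y" 0 "- 3"] cont y by fastforce
  have f1: "0 < f 1" "f (29/25) < 0" using \<alpha> by (simp_all add: f_def power3_eq_cube)
  then obtain r1 where r1': "1 \<le> r1" "r1 \<le> 29/25" "f r1 = 0"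
    using IVT2'[of f "29/25" 0 1] cont by auto
  moreover have "r1 \<noteq> 1" "r1 \<noteq> 29/25" using f1 r1'(3) less_irrefl by metis+
  ultimately have r1: "f r1 = 0" "1 < r1" "r1 < 29/25" by auto
  define r2 where "r2 = - (r0 + r1)"
  have quad: "\<alpha> * (r0\<^sup>2 + r0 * r1 + r1\<^sup>2) = 1"
  proof -
    have "f r1 - f r0 = (r1 - r0) * (\<alpha> * (r0\<^sup>2 + r0 * r1 + r1\<^sup>2) - 1)"
      by (simp add: f_def power2_eq_square power3_eq_cube algebra_simps)
    then show ?thesis using r0 r1 by simp
  qed
  have fact: "f t = \<alpha> * (t - r0) * (t - r1) * (t - r2)" for t
  proof -
    have "f t = f t - f r1 + (t - r1) * (1 - \<alpha> * (r0\<^sup>2 + r0 * r1 + r1\<^sup>2))"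
      using r1 quad by simp
    also have "\<dots> = \<alpha> * (t - r0) * (t - r1) * (t - r2)"
      by (simp add: f_def r2_def power2_eq_square power3_eq_cube algebra_simps)
    finally show ?thesis .
  qed
  have "{t. f t = 0} = {r0, r1, r2}"
    unfolding fact using \<alpha> by auto
  moreover have ord: "r0 < r1" "r1 < r2" using r0 r1 by (auto simp: r2_def)
  ultimately have "t2 \<alpha> = r1"
    unfolding t2_def f_def[symmetric] by (simp add: sorted_list_of_set_insert_remove)
  then show "\<alpha> * t2 \<alpha> ^ 3 - t2 \<alpha> + 1 = 0" "1 < t2 \<alpha>" "t2 \<alpha> < 29/25"
    using r1 by (auto simp: f_def)
qed

text \<open>
  From \<open>t\<^sub>2 = 1 + \<alpha> t\<^sub>2\<^sup>3 \<ge> 1 + \<alpha>\<close>: the condition \<open>l > t\<^sub>2\<^sup>3\<close> makes the interval long enough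
  to contain the point \<open>1 + p\<^sub>1 + 3 p\<^sub>1\<^sup>2\<close>, at which \<open>C\<close> is no longer positive.\<close>

lemma t2_cube_gt:
  assumes \<alpha>: "0 < \<alpha>" "\<alpha> \<le> 1/10"
  shows "1 + 3 * \<alpha> < t2 \<alpha> ^ 3"
proof -
  define t where "t = t2 \<alpha>"
  have t: "\<alpha> * t ^ 3 = t - 1" "1 < t" using t2_root[OF \<alpha>] by (auto simp: t_def)
  have "\<alpha> * 1 \<le> \<alpha> * t ^ 3" using t \<alpha> by (intro mult_left_mono one_le_power) auto
  then have "(1 + \<alpha>) ^ 3 \<le> t ^ 3" using t \<alpha> by (intro power_mono) auto
  moreover have "(1 + \<alpha>) ^ 3 = 1 + 3 * \<alpha> + (3 * \<alpha>\<^sup>2 + \<alpha> ^ 3)"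
    by (simp add: eval_nat_numeral algebra_simps)
  moreover have "0 < 3 * \<alpha>\<^sup>2 + \<alpha> ^ 3" using \<alpha> by (simp add: pos_add_strict)
  ultimately show ?thesis unfolding t_def by linarith
qed

text \<open>
  The two strict inequalities in \<open>admissible\<close> hold at \<open>l = t\<^sub>2\<^sup>3\<close> itself, where
  \<open>1 + l \<alpha> = t\<^sub>2 < 29/25\<close>, and are open conditions on \<open>l\<close>.\<close>

lemma eventually_admissible:
  assumes \<alpha>: "0 < \<alpha>" "\<alpha> \<le> 1/10"
  shows "eventually (admissible \<alpha>) (at_right (t2 \<alpha> ^ 3))"
proof -
  define t where "t = t2 \<alpha>"
  define u where "u l = 1 - \<alpha> * (1 + l * \<alpha>)\<^sup>2" for l
  define v where "v l = 1 - 2 * \<alpha> * (1 + l * \<alpha>) / (u l)\<^sup>2" for l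
  have t: "1 + t ^ 3 * \<alpha> = t" "1 < t" "t < 29/25"
    using t2_root[OF \<alpha>] by (auto simp: t_def mult.commute)
  have "\<alpha> * t\<^sup>2 \<le> 1/10 * (29/25)\<^sup>2"
    using \<alpha> t by (intro mult_mono power_mono) auto
  then have u: "43/50 < u (t ^ 3)" using t by (simp add: u_def power2_eq_square)
  have v: "0 < v (t ^ 3)"
  proof -
    have "(43/50)\<^sup>2 < (u (t ^ 3))\<^sup>2" using u by (intro power_strict_mono) auto
    moreover have "\<alpha> * t \<le> 1/10 * (29/25)" using \<alpha> t by (intro mult_mono) auto
    ultimately have "2 * \<alpha> * t < (u (t ^ 3))\<^sup>2" by (simp add: power2_eq_square)
    then show ?thesis using u t by (simp add: v_def)
  qed
  have cu: "isCont u (t ^ 3)" unfolding u_def by (intro continuous_intros)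
  then have cv: "isCont v (t ^ 3)" unfolding v_def using u by (intro continuous_intros) auto
  have near: "\<forall>\<^sub>F l in at_right (t ^ 3). 0 < f l" if "isCont f (t ^ 3)" "0 < f (t ^ 3)" for f :: "real \<Rightarrow> real"
    using that by (intro order_tendstoD(1)[OF tendsto_within_subset[where S = UNIV]]) (auto simp: isCont_def)
  have "\<forall>\<^sub>F l in at_right (t ^ 3). 0 < u l" "\<forall>\<^sub>F l in at_right (t ^ 3). 0 < v l"
    using near[OF cu] near[OF cv] u v by auto
  moreover have "\<forall>\<^sub>F l in at_right (t ^ 3). t ^ 3 < l" by (rule eventually_at_right_less)
  ultimately show ?thesis
    unfolding t_def[symmetric]
    by eventually_elim (simp add: admissible_def u_def v_def t_def)
qed

section \<open>The zero of the generating function\<close>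

context gap_submultiplicative
begin

text \<open>
  To second order the equation \<open>r = 1 + q\<^sub>1 r\<^sup>2\<close> has the solution \<open>1 + q\<^sub>1 + 2 q\<^sub>1\<^sup>2\<close>. The coefficient \<open>3\<close> in
  place of \<open>2\<close> leaves a margin \<open>-q\<^sub>1\<^sup>2\<close>, which outweighs the higher-order terms of \<open>alt_gf_le\<close> as long
  as \<open>q\<^sub>1 \<le> 1/10\<close>.\<close>

lemma alt_gf_nonpos_right_of_1:
  assumes small: "q 1 \<le> 1/10"
  shows "alt_gf q (1 + q 1 + 3 * (q 1)\<^sup>2) \<le> (0 :: real)"
proof -
  define e where "e = q 1"
  define v where "v = 1 + 3 * e"
  define r where "r = 1 + e * v"
  have e: "0 < e" "e \<le> 1/10" using small q_1_pos by (auto simp: e_def)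
  \<comment> \<open>The numerical constants below are bounds that hold up to the extreme case e = 1/10, r = 113/100.\<close>
  have v: "1 \<le> v" "v \<le> 13/10" using e by (auto simp: v_def)
  have ev: "e * v \<le> 13/100" using mult_mono[OF e(2) v(2)] e v by simp
  have r: "1 \<le> r" "r \<le> 113/100" using e v ev by (auto simp: r_def)
  have "e * r\<^sup>2 \<le> 1/10 * (113/100)\<^sup>2" using e r by (intro mult_mono power_mono) auto
  then have s: "e * r\<^sup>2 \<le> 13/100" by (simp add: power2_eq_square)
  have "r ^ 3 \<le> (113/100) ^ 3" using r by (intro power_mono) auto
  then have "r ^ 3 \<le> 145/100" by (simp add: power3_eq_cube)
  also have "\<dots> \<le> 5/3 * (1 - e * r\<^sup>2)" using s by simp
  finally have r3: "r ^ 3 / (1 - e * r\<^sup>2) \<le> 5/3" using s by (subst pos_divide_le_eq) auto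
  have "alt_gf q r \<le> 1 - r + e * r\<^sup>2 + (r - 1) * e\<^sup>2 * r ^ 3 / (1 - e * r\<^sup>2)"
    using alt_gf_le[of r] r s by (simp add: e_def)
  also have "(r - 1) * e\<^sup>2 * r ^ 3 / (1 - e * r\<^sup>2) \<le> (r - 1) * e\<^sup>2 * (5/3)"
    using mult_left_mono[OF r3, of "(r - 1) * e\<^sup>2"] r by simp
  also have "1 - r + e * r\<^sup>2 + (r - 1) * e\<^sup>2 * (5/3) = e\<^sup>2 * (- 1 + 6 * e + e * (v * v) + 5/3 * (e * v))"
    by (simp add: r_def v_def power2_eq_square algebra_simps)
  also have "\<dots> \<le> e\<^sup>2 * 0"
  proof (intro mult_left_mono)
    have "e * (v * v) \<le> e * (13/10 * (13/10))" using v e by (intro mult_left_mono mult_mono) auto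
    then show "- 1 + 6 * e + e * (v * v) + 5/3 * (e * v) \<le> 0" using ev e by linarith
  qed simp
  finally show ?thesis by (simp add: r_def v_def e_def power2_eq_square algebra_simps)
qed

text \<open>
  Since \<open>r \<le> 113/100\<close>, the tail bound \<open>q\<^sub>1\<^sup>3 r\<^sup>6 / (1 - q\<^sub>1 r\<^sup>2)\<close> is at most \<open>12/5 q\<^sub>1\<^sup>3\<close>, so that the
  equation for the zero is an instance of the hypothesis of \<open>newton_remainder\<close>.\<close>

lemma alt_gf_zero_expansion:
  assumes small: "q 1 \<le> 1/10"
    and r: "1 \<le> r" "r \<le> 1 + q 1 + 3 * (q 1)\<^sup>2" and zero: "alt_gf q r = (0 :: real)"
  shows "\<bar>r - (1 + q 1 - q 2 + q 3 - q 4 + 2 * (q 1)\<^sup>2 + 3 * (q 2)\<^sup>2 - 5 * q 1 * q 2)\<bar>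
    \<le> (15 + 75 * q 1) * q 1 ^ 3"
proof -
  have e: "0 < q 1" "(q 1)\<^sup>2 \<le> 1/10 * q 1"
    using small q_1_pos by (auto simp: power2_eq_square intro: mult_right_mono)
  have r': "r \<le> 113/100" using r e small by linarith
  have "q 1 * r\<^sup>2 \<le> 1/10 * (113/100)\<^sup>2" using e r r' small by (intro mult_mono power_mono) auto
  then have s: "q 1 * r\<^sup>2 \<le> 13/100" by (simp add: power2_eq_square)
  define R where "R = alt_gf q r - (1 - r + q 1 * r\<^sup>2 - q 2 * r ^ 3 + q 3 * r ^ 4 - q 4 * r ^ 5)"
  have "\<bar>R\<bar> \<le> q 1 ^ 3 * (r ^ 6 / (1 - q 1 * r\<^sup>2))"
    using alt_gf_tail[of r] r r' s by (simp add: R_def)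
  also have "\<dots> \<le> q 1 ^ 3 * (12/5)"
  proof (intro mult_left_mono)
    have "r ^ 6 \<le> (113/100) ^ 6" using r r' by (intro power_mono) auto
    also have "\<dots> \<le> 12/5 * (1 - q 1 * r\<^sup>2)" using s by (simp add: eval_nat_numeral)
    finally show "r ^ 6 / (1 - q 1 * r\<^sup>2) \<le> 12/5" using s by (subst pos_divide_le_eq) auto
  qed (use e in simp)
  finally have R: "\<bar>R\<bar> \<le> 12/5 * q 1 ^ 3" by simp
  have q: "q 2 \<le> q 1" "q 4 \<le> q 3" "q 3 \<le> (q 1)\<^sup>2"
    using q_Suc_le[of 1] q_Suc_le[of 3] q_gap[of 1] by (simp_all add: eval_nat_numeral)
  have "\<bar>(r - 1) - (q 1 - q 2 + q 3 - q 4 + 2 * (q 1)\<^sup>2 + 3 * (q 2)\<^sup>2 - 5 * q 1 * q 2)\<bar>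
      \<le> (15 + 75 * q 1) * q 1 ^ 3"
    by (rule newton_remainder[OF e(1) small q_nonneg q(1) q_nonneg q(2,3) _ _ R])
      (use r zero in \<open>auto simp: R_def\<close>)
  then show ?thesis by (simp add: algebra_simps)
qed

text \<open>
  The function is positive at \<open>1\<close>, not positive at \<open>1 + q\<^sub>1 + 3 q\<^sub>1\<^sup>2\<close>, and strictly decreasing on
  \<open>[1, b]\<close>, because the bound \<open>alt_gf'_le\<close> increases with \<open>r\<close> and is negative at \<open>b\<close>.\<close>

lemma alt_gf_unique_zero:
  fixes b :: real
  assumes small: "q 1 \<le> 1/10" and q2: "q 2 < q 1"
    and b: "1 + q 1 + 3 * (q 1)\<^sup>2 < b" "q 1 * b\<^sup>2 < 1"
    and neg: "2 * q 1 * b / (1 - q 1 * b\<^sup>2)\<^sup>2 < 1"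
  obtains \<zeta> where "\<zeta> \<in> {1<..<b}" "\<zeta> \<le> 1 + q 1 + 3 * (q 1)\<^sup>2" "alt_gf q \<zeta> = 0" "alt_gf' q \<zeta> < 0"
    "\<And>\<mu>. \<mu> \<in> {1<..<b} \<Longrightarrow> alt_gf q \<mu> = 0 \<Longrightarrow> \<mu> = \<zeta>"
proof -
  let ?r = "1 + q 1 + 3 * (q 1)\<^sup>2"
  have disc: "q 1 * r\<^sup>2 < 1" if "r \<in> {1..b}" for r
  proof -
    have "q 1 * r\<^sup>2 \<le> q 1 * b\<^sup>2" using that q_1_pos by (intro mult_left_mono power_mono) auto
    then show ?thesis using b by simp
  qed
  have deriv: "(alt_gf q has_real_derivative alt_gf' q r) (at r)" if "r \<in> {1..b}" for r
    using alt_gf_deriv_sums(1)[of r] disc[OF that] by simp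
  have deriv_neg: "alt_gf' q r < 0" if "r \<in> {1..b}" for r
  proof -
    have "q 1 * r\<^sup>2 \<le> q 1 * b\<^sup>2" using that q_1_pos by (intro mult_left_mono power_mono) auto
    then have "(1 - q 1 * b\<^sup>2)\<^sup>2 \<le> (1 - q 1 * r\<^sup>2)\<^sup>2" using b by (intro power_mono) auto
    then have "2 * q 1 * r / (1 - q 1 * r\<^sup>2)\<^sup>2 \<le> 2 * q 1 * b / (1 - q 1 * b\<^sup>2)\<^sup>2"
      using that b q_1_pos by (intro frac_le mult_left_mono) auto
    then show ?thesis using alt_gf'_le[of r] that disc[OF that] neg by simp
  qed
  have less: "alt_gf q t < (alt_gf q s :: real)" if "1 \<le> s" "s < t" "t \<le> b" for s t
  proof (rule DERIV_neg_imp_decreasing[OF that(2)])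
    fix r assume "s \<le> r" "r \<le> t"
    then have "r \<in> {1..b}" using that by simp
    then show "\<exists>y. (alt_gf q has_real_derivative y) (at r) \<and> y < 0"
      using deriv deriv_neg by blast
  qed
  have r1: "1 \<le> ?r" using q_1_pos by simp
  have pos: "0 < alt_gf q (1 :: real)" using alt_gf_at_1_pos small q2 by simp
  have "continuous_on {1..?r} (alt_gf q :: real \<Rightarrow> real)"
    using b by (intro DERIV_continuous_on[where D = "alt_gf' q"] has_field_derivative_at_within[OF deriv]) auto
  then obtain \<zeta> where z: "1 \<le> \<zeta>" "\<zeta> \<le> ?r" "alt_gf q \<zeta> = 0"
    using IVT2'[of "alt_gf q" ?r 0 1] alt_gf_nonpos_right_of_1[OF small] pos r1 by auto
  have "\<zeta> \<noteq> 1" using z pos by auto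
  show thesis
  proof
    show "\<zeta> \<in> {1<..<b}" "\<zeta> \<le> ?r" "alt_gf q \<zeta> = 0" using z b \<open>\<zeta> \<noteq> 1\<close> by auto
    show "alt_gf' q \<zeta> < 0" using deriv_neg z b by simp
    show "\<mu> = \<zeta>" if "\<mu> \<in> {1<..<b}" "alt_gf q \<mu> = 0" for \<mu>
      using less[of \<mu> \<zeta>] less[of \<zeta> \<mu>] that z b by force
  qed
qed

text \<open>
  The derivative at a real point is the same for the real and for the complex function, so a zero
  with nonvanishing real derivative is simple in the complex plane.\<close>

lemma zorder_alt_gf_eq_1:
  fixes r :: real
  assumes disc: "q 1 * r\<^sup>2 < 1" and zero: "alt_gf q r = 0" and deriv: "alt_gf' q r \<noteq> 0"
  shows "zorder (alt_gf q) (complex_of_real r) = 1"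
proof -
  define S where "S = ball (0 :: complex) (1 / sqrt (q 1))"
  have S: "w \<in> S \<longleftrightarrow> q 1 * (norm w)\<^sup>2 < 1" for w
    using q_1_pos disc_iff[of "norm w"] by (simp add: S_def field_simps)
  have der: "(alt_gf q has_field_derivative alt_gf' q w) (at w)" if "w \<in> S" for w :: complex
    using that alt_gf_deriv_sums(1) by (simp add: S)
  have rS: "complex_of_real r \<in> S" using disc by (simp add: S)
  show ?thesis
  proof (rule zorder_zero_eqI)
    show "alt_gf q holomorphic_on S"
      unfolding holomorphic_on_def field_differentiable_def
      using der has_field_derivative_at_within by blast
    show "open S" by (simp add: S_def)
    show "complex_of_real r \<in> S" by (rule rS)
    show "(deriv ^^ i) (alt_gf q) (complex_of_real r) = 0" if "i < nat 1" for i
      using that zero disc by (simp add: alt_gf_of_real)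
    show "(deriv ^^ nat 1) (alt_gf q) (complex_of_real r) \<noteq> 0"
      using DERIV_imp_deriv[OF der[OF rS]] deriv disc by (simp add: alt_gf'_of_real)
  qed simp
qed

end

section \<open>The expansion of the zero\<close>

theorem theorem2p1:
  fixes M :: "'a measure" and X :: "nat \<Rightarrow> 'a \<Rightarrow> real" and x \<alpha> :: real
  assumes "prob_space M"
    and "\<forall>n\<ge>1. X n \<in> borel_measurable M"
    and "strictly_stationary M X"
    and "one_dependent M X"
    and "Inf (ereal ` {u. 0 < cdf (distr M borel (X 1)) u}) < ereal x"
    and "ereal x < Sup (ereal ` {u. cdf (distr M borel (X 1)) u < 1})"
    and "0 < p M X x 1"
    and "p M X x 1 \<le> \<alpha>"
    and "\<alpha> \<le> 0.1"
  shows "eventually (admissible \<alpha>) (at_right (t2 \<alpha> ^ 3)) \<and>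
    (\<forall>l. admissible \<alpha> l \<longrightarrow>
      (\<exists>\<zeta>. \<zeta> \<in> {1 <..< 1 + l * p M X x 1} \<and>
        C M X x (of_real \<zeta>) = 0 \<and>
        (\<forall>\<mu>\<in>{1 <..< 1 + l * p M X x 1}. C M X x (of_real \<mu>) = 0 \<longrightarrow> \<mu> = \<zeta>) \<and>
        zorder (C M X x) (of_real \<zeta>) = 1 \<and>
        \<bar>\<zeta> - (1 + p M X x 1 - p M X x 2 + p M X x 3 - p M X x 4
              + 2 * (p M X x 1)\<^sup>2 + 3 * (p M X x 2)\<^sup>2 - 5 * p M X x 1 * p M X x 2)\<bar>
          \<le> K \<alpha> l * (p M X x 1) ^ 3))"
proof -
  interpret prob_space M by fact
  have meas: "\<And>n. 1 \<le> n \<Longrightarrow> X n \<in> borel_measurable M" using assms(2) by blast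
  note stat = assms(3) and dep = assms(4)
  let ?e = "p M X x 1"
  have e: "0 < ?e" "?e \<le> \<alpha>" "?e \<le> 1/10" and \<alpha>: "0 < \<alpha>" "\<alpha> \<le> 1/10"
    using assms(7-9) by auto
  interpret gap_submultiplicative "p M X x"
  proof
    show "p M X x 0 = 1" by (simp add: p_def)
  qed (use e min_gt_prob_nonneg min_gt_prob_Suc_le[OF meas] min_gt_prob_gap[OF meas stat dep] in auto)
  have p2: "p M X x 2 < ?e"
    using min_gt_prob_2_less_1[OF meas stat dep] e by simp
  have C_eq: "C M X x = alt_gf (p M X x)"
    by (rule ext) (simp add: C_def alt_gf_def)
  have zero: "\<exists>\<zeta>. \<zeta> \<in> {1 <..< 1 + l * ?e} \<and> C M X x (of_real \<zeta>) = 0 \<and>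
      (\<forall>\<mu>\<in>{1 <..< 1 + l * ?e}. C M X x (of_real \<mu>) = 0 \<longrightarrow> \<mu> = \<zeta>) \<and>
      zorder (C M X x) (of_real \<zeta>) = 1 \<and>
      \<bar>\<zeta> - (1 + ?e - p M X x 2 + p M X x 3 - p M X x 4
            + 2 * ?e\<^sup>2 + 3 * (p M X x 2)\<^sup>2 - 5 * ?e * p M X x 2)\<bar> \<le> K \<alpha> l * ?e ^ 3"
    if adm: "admissible \<alpha> l" for l
  proof -
    let ?b = "1 + l * ?e" and ?c = "1 + l * \<alpha>"
    have l: "1 + 3 * \<alpha> < l" using t2_cube_gt[OF \<alpha>] adm by (simp add: admissible_def)
    have "(1 + 3 * ?e) * ?e < l * ?e" using l e by (intro mult_strict_right_mono) auto
    then have b: "1 + ?e + 3 * ?e\<^sup>2 < ?b" by (simp add: power2_eq_square algebra_simps)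
    have bc: "1 \<le> ?b" "?b \<le> ?c" using l \<alpha> e by (auto intro: mult_left_mono)
    have le: "?e * ?b\<^sup>2 \<le> \<alpha> * ?c\<^sup>2" using bc e by (intro mult_mono power_mono) auto
    have c: "\<alpha> * ?c\<^sup>2 < 1" "2 * \<alpha> * ?c / (1 - \<alpha> * ?c\<^sup>2)\<^sup>2 < 1"
      using adm by (auto simp: admissible_def)
    have disc: "?e * ?b\<^sup>2 < 1" using le c by simp
    have "2 * ?e * ?b / (1 - ?e * ?b\<^sup>2)\<^sup>2 \<le> 2 * \<alpha> * ?c / (1 - \<alpha> * ?c\<^sup>2)\<^sup>2"
    proof (rule frac_le)
      show "2 * ?e * ?b \<le> 2 * \<alpha> * ?c" using bc e by (intro mult_mono) auto
      show "(1 - \<alpha> * ?c\<^sup>2)\<^sup>2 \<le> (1 - ?e * ?b\<^sup>2)\<^sup>2" using le c by (intro power_mono) auto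
    qed (use bc \<alpha> c in auto)
    then have neg: "2 * ?e * ?b / (1 - ?e * ?b\<^sup>2)\<^sup>2 < 1" using c by linarith
    obtain \<zeta> where z: "\<zeta> \<in> {1<..<?b}" "\<zeta> \<le> 1 + ?e + 3 * ?e\<^sup>2"
        "alt_gf (p M X x) \<zeta> = 0" "alt_gf' (p M X x) \<zeta> < 0"
      and uniq: "\<And>\<mu>. \<mu> \<in> {1<..<?b} \<Longrightarrow> alt_gf (p M X x) \<mu> = 0 \<Longrightarrow> \<mu> = \<zeta>"
      using alt_gf_unique_zero[OF e(3) p2 b disc neg] by blast
    have in_disc: "?e * r\<^sup>2 < 1" if "r \<in> {1<..<?b}" for r
    proof -
      have "?e * r\<^sup>2 \<le> ?e * ?b\<^sup>2" using that e by (intro mult_left_mono power_mono) auto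
      then show ?thesis using disc by simp
    qed
    have C_real: "C M X x (of_real r) = of_real (alt_gf (p M X x) r)" if "r \<in> {1<..<?b}" for r
      unfolding C_eq by (rule alt_gf_of_real[OF in_disc[OF that]])
    have "(15 + 75 * ?e) * ?e ^ 3 \<le> K \<alpha> l * ?e ^ 3"
      using K_lower_bound[OF \<alpha> _ adm] l \<alpha> e by (intro mult_right_mono) auto
    then have "\<bar>\<zeta> - (1 + ?e - p M X x 2 + p M X x 3 - p M X x 4
        + 2 * ?e\<^sup>2 + 3 * (p M X x 2)\<^sup>2 - 5 * ?e * p M X x 2)\<bar> \<le> K \<alpha> l * ?e ^ 3"
      using alt_gf_zero_expansion[OF e(3) _ z(2,3)] z(1) by simp
    moreover have "zorder (C M X x) (of_real \<zeta>) = 1"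
      unfolding C_eq using zorder_alt_gf_eq_1[OF in_disc[OF z(1)] z(3)] z(4) by simp
    moreover have "C M X x (of_real \<zeta>) = 0" using C_real[OF z(1)] z(3) by simp
    moreover have "\<mu> = \<zeta>" if "\<mu> \<in> {1<..<?b}" "C M X x (of_real \<mu>) = 0" for \<mu>
      using uniq[OF that(1)] C_real[OF that(1)] that(2) by simp
    ultimately show ?thesis using z(1) by blast
  qed
  show ?thesis
    using eventually_admissible[OF \<alpha>] zero by blast
qed

end
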